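(* Let $\mathbf{U}=\bigvee_{p\in\mathbb{P}}\mathbf{Ab}(p)*\mathbf{Ab}(p-1)$. Then the variety of groups generated by $\mathbf{U}$ is the variety of all metabelian groups, i.e. $\mathcal{V}(\mathbf{U})=\mathcal{M}$.
   Context: A pseudovariety is a class of finite groups closed under taking subgroups, homomorphic images and finitary direct products; $\bigvee$ denotes join (smallest pseudovariety containing all the given ones). $\mathbb{P}$ is the set of all primes. $\mathbf{Ab}(n)$ is the pseudovariety of finite abelian groups of exponent dividing $n$. For pseudovarieties $\mathbf{V},\mathbf{W}$, $\mathbf{V}*\mathbf{W}$ is the pseudovariety of all finite groups $G$ having a normal subgroup $N\in\mathbf{V}$ with $G/N\in\mathbf{W}$. A variety of groups is a class of groups closed under subgroups, homomorphic images and arbitrary direct products; $\mathcal{V}(C)$ is the smallest variety containing the class $C$ of groups. A group $G$ is metabelian if $[G,G]$ is abelian; $\mathcal{M}$ is the variety of all metabelian groups. *)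

theory Defs
  imports
    "HOL-Algebra.Product_Groups"
    "HOL-Algebra.Generated_Groups"
    "HOL-Computational_Algebra.Primes"
begin

text \<open>
  A class of groups is a set \<open>K :: 'u monoid set\<close> of groups with elements in a fixed universe
  type \<open>'u\<close>. All classes of interest contain every isomorphic copy inside \<open>'u\<close> of each of their
  members. Since \<^const>\<open>FactGroup\<close> and \<^const>\<open>product_group\<close> change the element type, they are
  compared with members of a class up to isomorphism. The next definition is the class of all groups
  over another element type \<open>'a\<close> that are isomorphic to a member of \<open>K\<close>.
\<close>

definition copies :: "'u monoid set \<Rightarrow> 'a monoid set" where
  "copies K = {G. group G \<and> (\<exists>H\<in>K. G \<cong> H)}"

definition closed_under_subgroups :: "'u monoid set \<Rightarrow> bool" where
  "closed_under_subgroups K \<longleftrightarrow> (\<forall>G\<in>K. \<forall>H. subgroup H G \<longrightarrow> G\<lparr>carrier := H\<rparr> \<in> K)"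

definition closed_under_images :: "'u monoid set \<Rightarrow> bool" where
  "closed_under_images K \<longleftrightarrow> (\<forall>G\<in>K. \<forall>H h. group H \<and> h \<in> epi G H \<longrightarrow> H \<in> K)"

text \<open>
  A direct product of members of \<open>K\<close> has element type \<open>'i \<Rightarrow> 'u\<close>; every group on \<open>'u\<close> isomorphic to it
  must be in \<open>K\<close>. Index sets inside \<open>'u\<close> suffice for arbitrary products: a product of nontrivial
  groups that has a copy in \<open>'u\<close> has at most as many factors as \<open>'u\<close> has elements, and trivial
  factors may be dropped. The empty index set yields the trivial groups.
\<close>

definition closed_under_products :: "'u monoid set \<Rightarrow> bool" where
  "closed_under_products K \<longleftrightarrow>
     (\<forall>(I :: 'u set) F H. F ` I \<subseteq> K \<and> group H \<and> product_group I F \<cong> H \<longrightarrow> H \<in> K)"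

definition closed_under_finite_products :: "'u monoid set \<Rightarrow> bool" where
  "closed_under_finite_products K \<longleftrightarrow>
     (\<forall>(I :: nat set) F H.
        finite I \<and> F ` I \<subseteq> K \<and> group H \<and> product_group I F \<cong> H \<longrightarrow> H \<in> K)"

definition pseudovariety :: "'u monoid set \<Rightarrow> bool" where
  "pseudovariety K \<longleftrightarrow>
     (\<forall>G\<in>K. group G \<and> finite (carrier G)) \<and>
     closed_under_subgroups K \<and> closed_under_images K \<and> closed_under_finite_products K"

definition variety :: "'u monoid set \<Rightarrow> bool" where
  "variety K \<longleftrightarrow>
     (\<forall>G\<in>K. group G) \<and>
     closed_under_subgroups K \<and> closed_under_images K \<and> closed_under_products K"

definition pseudovariety_join :: "'u monoid set set \<Rightarrow> 'u monoid set" where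
  "pseudovariety_join \<K> = \<Inter>{P. pseudovariety P \<and> \<Union>\<K> \<subseteq> P}"

definition generated_variety :: "'u monoid set \<Rightarrow> 'u monoid set" where
  "generated_variety C = \<Inter>{K. variety K \<and> C \<subseteq> K}"

definition Ab :: "nat \<Rightarrow> 'u monoid set" where
  "Ab n = {G. comm_group G \<and> finite (carrier G) \<and> (\<forall>x\<in>carrier G. x [^]\<^bsub>G\<^esub> n = \<one>\<^bsub>G\<^esub>)}"

definition pv_extension :: "'u monoid set \<Rightarrow> 'u monoid set \<Rightarrow> 'u monoid set" where
  "pv_extension V W =
     {G. group G \<and> finite (carrier G) \<and>
         (\<exists>N. N \<lhd> G \<and> G\<lparr>carrier := N\<rparr> \<in> V \<and> G Mod N \<in> copies W)}"

definition U_class :: "'u monoid set" where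
  "U_class = pseudovariety_join {pv_extension (Ab p) (Ab (p - 1)) | p. prime p}"

definition metabelian_groups :: "'a monoid set" where
  "metabelian_groups =
     {G. group G \<and> comm_group (G\<lparr>carrier := derived G (carrier G)\<rparr>)}"

text \<open>
  Membership of a group \<open>G\<close> in the variety generated by a class does not depend on the universe as
  soon as the latter is large enough: a group of cardinality at most \<open>\<kappa>\<close>, \<open>\<kappa>\<close> infinite, in the
  variety generated by a class of groups of cardinality at most \<open>\<kappa>\<close> is an image of a subgroup of a
  product of at most \<open>\<kappa>\<close> members of that class,
  and such a product has cardinality at most \<open>2 ^ \<kappa>\<close>. In a smaller universe
  \<^const>\<open>closed_under_products\<close> may be too weak: on a countable type no infinite product of nontrivial
  groups has a copy. Hence groups on \<open>'a\<close> are to be tested in a universe into which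
  \<open>('a + nat) set\<close> embeds; the summand \<open>nat\<close> makes \<open>\<kappa>\<close> infinite.
\<close>

definition large_universe :: "'a itself \<Rightarrow> 'u itself \<Rightarrow> bool" where
  "large_universe _ _ \<longleftrightarrow> (\<exists>e :: ('a + nat) set \<Rightarrow> 'u. inj e)"

lemma pseudovariety_finite_groups: "pseudovariety {G :: 'u monoid. group G \<and> finite (carrier G)}"
  unfolding pseudovariety_def
proof (intro conjI)
  show "closed_under_subgroups {G :: 'u monoid. group G \<and> finite (carrier G)}"
    unfolding closed_under_subgroups_def
    by (auto intro: group.subgroup_imp_group finite_subset dest: subgroup.subset)
  show "closed_under_images {G :: 'u monoid. group G \<and> finite (carrier G)}"
    unfolding closed_under_images_def epi_def by (auto, metis finite_imageI)
  have "finite (carrier H)"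
    if fin: "finite I" "F ` I \<subseteq> {G. group G \<and> finite (carrier G)}" and iso: "product_group I F \<cong> H"
    for I :: "nat set" and F and H :: "'u monoid"
  proof -
    have "finite (carrier (product_group I F))"
      using fin by (auto intro!: finite_PiE)
    moreover obtain h where "bij_betw h (carrier (product_group I F)) (carrier H)"
      using iso by (auto simp: is_iso_def iso_def)
    ultimately show ?thesis by (simp add: bij_betw_finite)
  qed
  then show "closed_under_finite_products {G :: 'u monoid. group G \<and> finite (carrier G)}"
    unfolding closed_under_finite_products_def by blast
qed auto

lemma pseudovariety_pseudovariety_join:
  assumes "\<forall>K\<in>\<K>. \<forall>G\<in>K. group G \<and> finite (carrier G)"
  shows "pseudovariety (pseudovariety_join \<K>)"
proof -
  have "{G. group G \<and> finite (carrier G)} \<in> {P. pseudovariety P \<and> \<Union>\<K> \<subseteq> P}"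
    using assms pseudovariety_finite_groups by blast
  then have 1: "\<forall>G\<in>pseudovariety_join \<K>. group G \<and> finite (carrier G)"
    unfolding pseudovariety_join_def by blast
  have 2: "closed_under_subgroups (pseudovariety_join \<K>)"
    unfolding pseudovariety_join_def closed_under_subgroups_def pseudovariety_def by simp
  have 3: "closed_under_images (pseudovariety_join \<K>)"
    unfolding pseudovariety_join_def closed_under_images_def pseudovariety_def by blast
  have 4: "closed_under_finite_products (pseudovariety_join \<K>)"
    unfolding closed_under_finite_products_def
  proof (intro allI impI)
    fix I :: "nat set" and F and H :: "'a monoid"
    assume *: "finite I \<and> F ` I \<subseteq> pseudovariety_join \<K> \<and> group H \<and> product_group I F \<cong> H"
    show "H \<in> pseudovariety_join \<K>"
      unfolding pseudovariety_join_def
    proof (intro InterI)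
      fix P assume P: "P \<in> {P. pseudovariety P \<and> \<Union>\<K> \<subseteq> P}"
      then have "F ` I \<subseteq> P" using * unfolding pseudovariety_join_def by blast
      with P * show "H \<in> P"
        unfolding pseudovariety_def closed_under_finite_products_def by blast
    qed
  qed
  show ?thesis using 1 2 3 4 unfolding pseudovariety_def by blast
qed

lemma variety_generated_variety:
  fixes C :: "'u monoid set"
  assumes "\<forall>G\<in>C. group G"
  shows "variety (generated_variety C)"
proof -
  have "variety {G :: 'u monoid. group G}"
    unfolding variety_def closed_under_subgroups_def closed_under_images_def
      closed_under_products_def
    by (auto intro: group.subgroup_imp_group)
  then have 1: "\<forall>G\<in>generated_variety C. group G"
    using assms unfolding generated_variety_def by blast
  have 2: "closed_under_subgroups (generated_variety C)"
    unfolding generated_variety_def closed_under_subgroups_def variety_def by simp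
  have 3: "closed_under_images (generated_variety C)"
    unfolding generated_variety_def closed_under_images_def variety_def by blast
  have 4: "closed_under_products (generated_variety C)"
    unfolding closed_under_products_def
  proof (intro allI impI)
    fix I :: "'u set" and F and H :: "'u monoid"
    assume *: "F ` I \<subseteq> generated_variety C \<and> group H \<and> product_group I F \<cong> H"
    show "H \<in> generated_variety C"
      unfolding generated_variety_def
    proof (intro InterI)
      fix K assume K: "K \<in> {K. variety K \<and> C \<subseteq> K}"
      then have "F ` I \<subseteq> K" using * unfolding generated_variety_def by blast
      with K * show "H \<in> K" unfolding variety_def closed_under_products_def by blast
    qed
  qed
  show ?thesis using 1 2 3 4 unfolding variety_def by blast
qed

end

theory Submission
  imports
    Defs
    "HOL-Algebra.Weak_Morphisms"
    "HOL-Number_Theory.Residues"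
    "HOL-Computational_Algebra.Polynomial"
    "HOL-Library.Countable"
begin

text \<open>
  One inclusion is a matter of closure properties: metabelian groups form a variety, the finite ones
  a pseudovariety, and an extension of an abelian group by an abelian group is metabelian.

  For the other one it is enough to know that a word which is trivial under every assignment in
  every group of affine maps \<open>z \<mapsto> a z + b\<close> over a prime field is a law of all metabelian groups.
  These affine groups are in \<open>Ab(p) * Ab(p - 1)\<close>, with the translations as normal subgroup. Given a
  metabelian group \<open>G\<close>, one then collects, for each word that is nontrivial at the elements of \<open>G\<close>,
  an assignment in an affine group where it is nontrivial; the product of these affine groups has a
  subgroup of which \<open>G\<close> is an image (\<open>metabelian_copy_in_variety\<close>). All index sets and carriers that
  occur are small enough for the given universe.

  The statement on words is proved by reading a word as a walk in the Cayley graph of a free abelian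
  group and counting how often each edge is traversed, with sign. On the one hand, the value of a
  word in a metabelian group is determined by these net counts: choosing representatives in \<open>G\<close> of the
  vertices, the value telescopes into a product of elements of the derived subgroup, one for each
  step, which may be reordered (\<open>word_trivial_if_net_zero\<close>). On the other hand, affine groups see all
  counts: if the variable \<open>x\<close> is the map \<open>z \<mapsto> t\<^sub>x z + b\<^sub>x\<close>, the translation part of a word is the sum
  of \<open>t\<^sup>v b\<^sub>x\<close> over the edges \<open>(v, x)\<close>, weighted with their counts; here \<open>t\<^sup>v\<close> is the product of the
  powers of the \<open>t\<^sub>y\<close> with the coordinates of \<open>v\<close> as exponents. Letting all \<open>t\<^sub>x\<close> be powers of one
  integer \<open>T\<close> with widely spread exponents, and exactly one \<open>b\<^sub>x\<close> be \<open>1\<close>, makes this a polynomial in \<open>T\<close>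
  whose coefficients are the counts. If the word is trivial for all primes and all \<open>T\<close>, then this
  polynomial is zero (\<open>net_zero_if_affine_trivial\<close>). This elementary argument takes the place of the
  Magnus embedding of free metabelian groups and its faithful specializations.
\<close>

section \<open>Words and their values\<close>

text \<open>
  A letter is a variable together with its sign, \<open>True\<close> standing for the exponent \<open>1\<close> and \<open>False\<close> for
  \<open>-1\<close>. Words are not reduced; two words are only ever compared through their values.
\<close>
type_synonym 'x gword = "('x \<times> bool) list"

primrec word_val :: "('a, 'm) monoid_scheme \<Rightarrow> ('x \<Rightarrow> 'a) \<Rightarrow> 'x gword \<Rightarrow> 'a" where
  "word_val G f [] = \<one>\<^bsub>G\<^esub>"
| "word_val G f (l # w) =
     (if snd l then f (fst l) else inv\<^bsub>G\<^esub> f (fst l)) \<otimes>\<^bsub>G\<^esub> word_val G f w"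

definition word_inv :: "'x gword \<Rightarrow> 'x gword" where
  "word_inv w = rev (map (\<lambda>(x, b). (x, \<not> b)) w)"

context group
begin

lemma word_val_closed [simp]: "range f \<subseteq> carrier G \<Longrightarrow> word_val G f w \<in> carrier G"
  by (induction w) auto

lemma word_val_append:
  "range f \<subseteq> carrier G \<Longrightarrow> word_val G f (u @ w) = word_val G f u \<otimes> word_val G f w"
proof (induction u)
  case (Cons l u)
  then have "f (fst l) \<in> carrier G" by auto
  with Cons show ?case by (simp add: m_assoc)
qed simp

lemma word_val_inv:
  assumes "range f \<subseteq> carrier G"
  shows "word_val G f (word_inv w) = inv (word_val G f w)"
proof (induction w)
  case Nil
  show ?case by (simp add: word_inv_def)
next
  case (Cons l w)
  obtain x b where l: "l = (x, b)" by fastforce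
  have x: "f x \<in> carrier G" using assms by auto
  have "word_inv (l # w) = word_inv w @ [(x, \<not> b)]" by (simp add: word_inv_def l)
  then show ?case using Cons x assms by (simp add: l word_val_append inv_mult_group)
qed

end

lemma (in group_hom) hom_word_val:
  "range f \<subseteq> carrier G \<Longrightarrow> h (word_val G f w) = word_val H (h \<circ> f) w"
proof (induction w)
  case (Cons l w)
  then have "f (fst l) \<in> carrier G" by auto
  with Cons show ?case by simp
qed simp

text \<open>
  The syntactic half of Birkhoff's theorem. The subgroup is generated by the range of \<open>x\<close>, and the map
  sends the value of a word at \<open>x\<close> to its value at \<open>y\<close>. It is well defined because two words with the
  same value at \<open>x\<close> differ by a word whose value there is \<open>\<one>\<close>.
\<close>
lemma word_laws_give_quotient_of_subgroup:
  assumes H: "group H" and G: "group G"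
    and x: "range x \<subseteq> carrier H" and y: "range y = carrier G"
    and law: "\<And>w. word_val H x w = \<one>\<^bsub>H\<^esub> \<Longrightarrow> word_val G y w = \<one>\<^bsub>G\<^esub>"
  obtains S h where "subgroup S H" "h \<in> epi (H\<lparr>carrier := S\<rparr>) G"
proof -
  interpret H: group H by fact
  interpret G: group G by fact
  define S where "S = range (word_val H x)"
  define h where "h s = word_val G y (SOME w. word_val H x w = s)" for s
  have y': "range y \<subseteq> carrier G" using y by simp
  have eq: "word_val G y u = word_val G y w" if "word_val H x u = word_val H x w" for u w
  proof -
    have "word_val H x (u @ word_inv w) = \<one>\<^bsub>H\<^esub>"
      using that x by (simp add: H.word_val_append H.word_val_inv)
    then have "word_val G y u \<otimes>\<^bsub>G\<^esub> inv\<^bsub>G\<^esub> word_val G y w = \<one>\<^bsub>G\<^esub>"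
      using law[of "u @ word_inv w"] y' by (simp add: G.word_val_append G.word_val_inv)
    then show ?thesis using y' by (metis G.inv_equality G.inv_inv G.inv_closed G.word_val_closed)
  qed
  have h: "h (word_val H x w) = word_val G y w" for w
    unfolding h_def by (rule eq) (rule someI[of _ w], simp)
  have S: "subgroup S H"
  proof (rule H.subgroupI)
    show "S \<subseteq> carrier H" "S \<noteq> {}" using x by (auto simp: S_def)
    show "inv\<^bsub>H\<^esub> a \<in> S" if "a \<in> S" for a
      using that x by (auto simp: S_def simp flip: H.word_val_inv)
    show "a \<otimes>\<^bsub>H\<^esub> b \<in> S" if "a \<in> S" "b \<in> S" for a b
      using that x by (auto simp: S_def simp flip: H.word_val_append)
  qed
  have "h \<in> epi (H\<lparr>carrier := S\<rparr>) G"
    unfolding epi_iff_subset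
  proof (intro conjI homI)
    fix a b assume "a \<in> carrier (H\<lparr>carrier := S\<rparr>)" "b \<in> carrier (H\<lparr>carrier := S\<rparr>)"
    then obtain u w where ab: "a = word_val H x u" "b = word_val H x w" by (auto simp: S_def)
    have "a \<otimes>\<^bsub>H\<^esub> b = word_val H x (u @ w)" using x by (simp add: ab H.word_val_append)
    then show "h (a \<otimes>\<^bsub>H\<lparr>carrier := S\<rparr>\<^esub> b) = h a \<otimes>\<^bsub>G\<^esub> h b"
      using y' by (simp add: h ab G.word_val_append)
  next
    show "h a \<in> carrier G" if "a \<in> carrier (H\<lparr>carrier := S\<rparr>)" for a
      using that y' by (auto simp: S_def h)
    show "carrier G \<subseteq> h ` carrier (H\<lparr>carrier := S\<rparr>)"
    proof
      fix g assume "g \<in> carrier G"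
      then obtain a where a: "g = y a" using y by auto
      then have "h (word_val H x [(a, True)]) = g" using h[of "[(a, True)]"] \<open>g \<in> carrier G\<close> by simp
      then show "g \<in> h ` carrier (H\<lparr>carrier := S\<rparr>)"
        by (intro image_eqI[of _ _ "word_val H x [(a, True)]"]) (simp_all add: S_def del: word_val.simps)
    qed
  qed
  with S show ?thesis by (rule that)
qed

section \<open>Words as walks\<close>

text \<open>
  A word is a walk in the Cayley graph of a free abelian group: each letter moves the current vertex
  \<open>v\<close> along an edge labelled \<open>x\<close>. The edge \<open>(v, x)\<close> leads from \<open>v\<close> to \<open>v + x\<close>, and a letter with
  exponent \<open>-1\<close> traverses such an edge backwards, which is recorded with the coefficient \<open>-1\<close>. Vertices
  have natural coordinates, so that they can serve as exponents in products of powers; the walk is a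
  faithful one as long as the starting vertex has all coordinates at least the length of the word.
\<close>
fun steps :: "('x \<Rightarrow> nat) \<Rightarrow> 'x gword \<Rightarrow> ((('x \<Rightarrow> nat) \<times> 'x) \<times> int) list" where
  "steps v [] = []"
| "steps v ((x, True) # w) = ((v, x), 1) # steps (v(x := Suc (v x))) w"
| "steps v ((x, False) # w) = ((v(x := v x - 1), x), - 1) # steps (v(x := v x - 1)) w"

fun walk_end :: "('x \<Rightarrow> nat) \<Rightarrow> 'x gword \<Rightarrow> ('x \<Rightarrow> nat)" where
  "walk_end v [] = v"
| "walk_end v ((x, True) # w) = walk_end (v(x := Suc (v x))) w"
| "walk_end v ((x, False) # w) = walk_end (v(x := v x - 1)) w"

text \<open>
  The net number of times that each edge is traversed. For the walk of a word this is, up to the shift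
  of the starting vertex, the family of coefficients of its Fox derivatives over the free abelian
  group.
\<close>
definition net :: "('e \<times> int) list \<Rightarrow> 'e \<Rightarrow> int" where
  "net ps e = (\<Sum>q\<leftarrow>filter (\<lambda>q. fst q = e) ps. snd q)"

lemma sum_list_net:
  fixes g :: "'e \<Rightarrow> int"
  assumes "finite E" "fst ` set ps \<subseteq> E"
  shows "(\<Sum>q\<leftarrow>ps. snd q * g (fst q)) = (\<Sum>e\<in>E. net ps e * g e)"
  using assms(2)
proof (induction ps)
  case Nil
  then show ?case by (simp add: net_def)
next
  case (Cons q ps)
  have "net (q # ps) e * g e = (if e = fst q then snd q * g e else 0) + net ps e * g e" for e
    by (auto simp: net_def algebra_simps)
  then show ?case using Cons assms(1) by (simp add: sum.distrib)
qed

definition list_prod :: "('a, 'm) monoid_scheme \<Rightarrow> ('e \<Rightarrow> 'a) \<Rightarrow> ('e \<times> int) list \<Rightarrow> 'a" where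
  "list_prod G c ps = foldr (\<lambda>q a. c (fst q) [^]\<^bsub>G\<^esub> snd q \<otimes>\<^bsub>G\<^esub> a) ps \<one>\<^bsub>G\<^esub>"

context comm_group
begin

lemma list_prod_closed [simp]:
  "c ` fst ` set ps \<subseteq> carrier G \<Longrightarrow> list_prod G c ps \<in> carrier G"
  by (induction ps) (auto simp: list_prod_def)

text \<open>
  In an abelian group all factors that belong to one edge can be collected, and what is left is shorter;
  so a product along a list depends on the net coefficients only.
\<close>
lemma list_prod_extract:
  assumes "range c \<subseteq> carrier G"
  shows "list_prod G c ps = c e [^] net ps e \<otimes> list_prod G c (filter (\<lambda>q. fst q \<noteq> e) ps)"
proof (induction ps)
  case Nil
  then show ?case by (simp add: list_prod_def net_def)
next
  case (Cons q ps)
  let ?r = "list_prod G c (filter (\<lambda>q. fst q \<noteq> e) ps)"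
  have mem: "c a \<in> carrier G" for a using assms by auto
  have r: "?r \<in> carrier G" using assms by (intro list_prod_closed) auto
  have "list_prod G c (q # ps) = c (fst q) [^] snd q \<otimes> (c e [^] net ps e \<otimes> ?r)"
    using Cons by (simp add: list_prod_def)
  moreover have "\<dots> = c e [^] net ps e \<otimes> (c (fst q) [^] snd q \<otimes> ?r)"
    using mem r by (simp add: m_lcomm)
  moreover have "c (fst q) [^] snd q \<otimes> (c e [^] net ps e \<otimes> ?r) = c e [^] (snd q + net ps e) \<otimes> ?r"
    if "fst q = e"
    using mem r that by (simp add: int_pow_mult m_assoc)
  ultimately show ?case by (auto simp: net_def list_prod_def)
qed

lemma list_prod_net_zero:
  assumes "range c \<subseteq> carrier G" "\<And>e. net ps e = 0"
  shows "list_prod G c ps = \<one>"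
  using assms(2)
proof (induction ps rule: length_induct)
  case (1 ps)
  show ?case
  proof (cases ps)
    case Nil
    then show ?thesis by (simp add: list_prod_def)
  next
    case (Cons q qs)
    let ?f = "filter (\<lambda>r. fst r \<noteq> fst q) ps"
    have "net ?f e = 0" for e
    proof (cases "e = fst q")
      case True
      then show ?thesis by (simp add: net_def)
    next
      case False
      then have "filter (\<lambda>r. fst r = e) ?f = filter (\<lambda>r. fst r = e) ps" by (auto intro: filter_cong)
      then show ?thesis using 1(2)[of e] by (simp add: net_def)
    qed
    moreover have "length ?f < length ps"
      using Cons length_filter_le[of "\<lambda>r. fst r \<noteq> fst q" qs] by (simp add: le_imp_less_Suc)
    ultimately have "list_prod G c ?f = \<one>" using 1(1) by blast
    then show ?thesis using list_prod_extract[OF assms(1), of ps "fst q"] 1(2) by simp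
  qed
qed

text \<open>
  How the image of a vertex in an abelian group changes along an edge.
\<close>
lemma finprod_pow_Suc:
  assumes "finite X" "x \<in> X" "range g \<subseteq> carrier G"
  shows "(\<Otimes>y\<in>X. g y [^] (v(x := Suc (v x))) y) = (\<Otimes>y\<in>X. g y [^] v y) \<otimes> g x"
proof -
  have mem: "g a \<in> carrier G" for a using assms by auto
  have "(\<Otimes>y\<in>X. g y [^] (v(x := Suc (v x))) y) = (\<Otimes>y\<in>X. g y [^] v y \<otimes> (if x = y then g y else \<one>))"
    using mem by (intro finprod_cong) (auto simp: simp_implies_def)
  also have "\<dots> = (\<Otimes>y\<in>X. g y [^] v y) \<otimes> (\<Otimes>y\<in>X. if x = y then g y else \<one>)"
    using mem by (intro finprod_multf) auto
  also have "(\<Otimes>y\<in>X. if x = y then g y else \<one>) = g x"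
    using assms mem by (intro finprod_singleton) auto
  finally show ?thesis .
qed

end

lemma walk_end_eq_sum:
  assumes "\<And>y. length w \<le> v y"
  shows "int (walk_end v w y) = int (v y) + (\<Sum>q\<leftarrow>steps v w. snd q * of_bool (snd (fst q) = y))"
  using assms
proof (induction v w rule: walk_end.induct)
  case (1 v)
  then show ?case by simp
next
  case (2 v x w)
  have "length w \<le> (v(x := Suc (v x))) z" for z using 2(2)[of z] by auto
  then have "int (walk_end (v(x := Suc (v x))) w y) = int ((v(x := Suc (v x))) y)
      + (\<Sum>q\<leftarrow>steps (v(x := Suc (v x))) w. snd q * of_bool (snd (fst q) = y))"
    by (rule 2(1))
  then show ?case by (cases "x = y") simp_all
next
  case (3 v x w)
  have "length w \<le> (v(x := v x - 1)) z" for z using 3(2)[of z] by auto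
  then have "int (walk_end (v(x := v x - 1)) w y) = int ((v(x := v x - 1)) y)
      + (\<Sum>q\<leftarrow>steps (v(x := v x - 1)) w. snd q * of_bool (snd (fst q) = y))"
    by (rule 3(1))
  then show ?case using 3(2)[of x] by (cases "x = y") simp_all
qed

text \<open>
  The coordinate \<open>y\<close> of the current vertex changes only along edges labelled \<open>y\<close>, by \<open>1\<close> for each
  traversal; so a walk without net traversals is closed.
\<close>
lemma walk_end_net_zero:
  assumes "\<And>y. length w \<le> v y" "\<And>e. net (steps v w) e = 0"
  shows "walk_end v w = v"
proof
  fix y
  show "walk_end v w y = v y"
    using walk_end_eq_sum[of w v y, OF assms(1)] assms(2)
      sum_list_net[of "fst ` set (steps v w)" "steps v w" "\<lambda>e. of_bool (snd e = y)"]
    by simp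
qed

text \<open>
  This is the heart of the matter: in an extension of an abelian group by an abelian group, the value
  of a word depends on its net edge traversals only. Choose for each vertex \<open>v\<close> an element \<open>s v\<close> of \<open>G\<close>
  over the corresponding element of the abelian quotient. For an edge from \<open>v\<close> to \<open>v + x\<close> the element
  \<open>c (v, x) = s v \<otimes> f x \<otimes> inv (s (v + x))\<close> lies in the abelian kernel, and the product of the letters of
  the word telescopes into the product of these elements along the walk.
\<close>
lemma (in group_hom) word_trivial_if_net_zero:
  assumes Q: "comm_group H" and surj: "h ` carrier G = carrier H"
    and ker: "comm_group (G\<lparr>carrier := kernel G H h\<rparr>)"
    and f: "range f \<subseteq> carrier G"
    and v0: "\<And>y. length w0 \<le> v0 y" and net0: "\<And>e. net (steps v0 w0) e = 0"
  shows "word_val G f w0 = \<one>"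
proof -
  interpret Q: comm_group H by fact
  let ?A = "G\<lparr>carrier := kernel G H h\<rparr>"
  interpret A: comm_group ?A by fact
  have fm: "f a \<in> carrier G" for a using f by auto
  define X where "X = fst ` set w0"
  have X: "finite X" by (simp add: X_def)
  define P where "P v = (\<Otimes>\<^bsub>H\<^esub>y\<in>X. h (f y) [^]\<^bsub>H\<^esub> (v y :: nat))" for v
  have "\<exists>g\<in>carrier G. h g = P v" for v
  proof -
    have "P v \<in> carrier H" unfolding P_def using fm by (intro Q.finprod_closed) auto
    then show ?thesis using surj by (metis imageE)
  qed
  then obtain s where s: "s v \<in> carrier G" "h (s v) = P v" for v by metis
  \<comment> \<open>Labels outside \<open>X\<close> never occur; the value \<open>\<one>\<close> only serves to keep \<open>c\<close> inside the kernel.\<close>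
  define c where "c e = (let v = fst e; x = snd e in if x \<in> X then s v \<otimes> f x \<otimes> inv (s (v(x := Suc (v x)))) else \<one>)" for e
  have P: "P (v(x := Suc (v x))) = P v \<otimes>\<^bsub>H\<^esub> h (f x)" if "x \<in> X" for v x
    unfolding P_def using that X fm by (intro Q.finprod_pow_Suc) auto
  have c: "range c \<subseteq> carrier ?A"
  proof -
    have "c (v, x) \<in> kernel G H h" for v x
    proof (cases "x \<in> X")
      case True
      have "P v \<in> carrier H" using s[of v] hom_closed by metis
      then have "h (c (v, x)) = \<one>\<^bsub>H\<^esub>" using s fm True by (simp add: c_def P)
      then show ?thesis using s fm True by (simp add: kernel_def c_def)
    qed (simp add: c_def kernel_def)
    then show ?thesis by auto
  qed
  have cm: "c e \<in> carrier ?A" for e using c by auto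
  have cG: "c e \<in> carrier G" for e using c by (auto simp: kernel_def)
  have cancel: "inv a \<otimes> (a \<otimes> b) = b" if "a \<in> carrier G" "b \<in> carrier G" for a b
    using that by (metis G.inv_closed G.l_inv G.l_one G.m_assoc)
  have key: "s v \<otimes> word_val G f w = list_prod ?A c (steps v w) \<otimes> s (walk_end v w)"
    if "\<And>y. length w \<le> v y" "fst ` set w \<subseteq> X" for v w
    using that
  proof (induction v w rule: walk_end.induct)
    case (1 v)
    then show ?case using s by (simp add: list_prod_def)
  next
    case (2 v x w)
    let ?v = "v(x := Suc (v x))"
    have x: "x \<in> X" using 2 by auto
    have "length w \<le> ?v y" for y using 2(2)[of y] by auto
    then have IH: "s ?v \<otimes> word_val G f w = list_prod ?A c (steps ?v w) \<otimes> s (walk_end ?v w)"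
      by (rule 2(1)) (use 2(3) in auto)
    have L: "list_prod ?A c (steps ?v w) \<in> carrier G"
      using A.list_prod_closed[of c "steps ?v w"] c by (auto simp: kernel_def)
    have "s v \<otimes> word_val G f ((x, True) # w) = c (v, x) \<otimes> (s ?v \<otimes> word_val G f w)"
      using s fm f x cancel by (simp add: c_def G.m_assoc)
    also have "\<dots> = (c (v, x) \<otimes> list_prod ?A c (steps ?v w)) \<otimes> s (walk_end ?v w)"
      using IH L cG s by (simp add: G.m_assoc)
    also have "c (v, x) \<otimes> list_prod ?A c (steps ?v w) = list_prod ?A c (steps v ((x, True) # w))"
      using A.int_pow_1[OF cm] by (simp add: list_prod_def)
    finally show ?case unfolding walk_end.simps .
  next
    case (3 v x w)
    let ?v = "v(x := v x - 1)"
    have x: "x \<in> X" using 3 by auto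
    have vx: "?v(x := Suc (?v x)) = v" using 3(2)[of x] by auto
    have "length w \<le> ?v y" for y using 3(2)[of y] by auto
    then have IH: "s ?v \<otimes> word_val G f w = list_prod ?A c (steps ?v w) \<otimes> s (walk_end ?v w)"
      by (rule 3(1)) (use 3(3) in auto)
    have L: "list_prod ?A c (steps ?v w) \<in> carrier G"
      using A.list_prod_closed[of c "steps ?v w"] c by (auto simp: kernel_def)
    have cx: "c (?v, x) = s ?v \<otimes> f x \<otimes> inv (s v)" using x vx by (simp add: c_def)
    have inv: "inv\<^bsub>?A\<^esub> c (?v, x) = inv (c (?v, x))"
      using G.m_inv_consistent[OF subgroup_kernel] cm by auto
    have "s v \<otimes> word_val G f ((x, False) # w) = inv (c (?v, x)) \<otimes> (s ?v \<otimes> word_val G f w)"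
      unfolding cx using s fm f x by (simp add: G.m_assoc G.inv_mult_group cancel)
    also have "\<dots> = (inv (c (?v, x)) \<otimes> list_prod ?A c (steps ?v w)) \<otimes> s (walk_end ?v w)"
      using IH L cG s by (simp add: G.m_assoc)
    also have "inv (c (?v, x)) \<otimes> list_prod ?A c (steps ?v w) = list_prod ?A c (steps v ((x, False) # w))"
      using A.int_pow_neg[OF cm, of "(?v,x)" 1] A.int_pow_1[OF cm] inv by (simp add: list_prod_def)
    finally show ?case unfolding walk_end.simps .
  qed
  have "s v0 \<otimes> word_val G f w0 = s v0"
    using key[OF v0] A.list_prod_net_zero[OF c net0] walk_end_net_zero[OF v0 net0] s
    by (simp add: X_def)
  then show ?thesis using s f by (simp add: G.r_cancel_one)
qed

section \<open>Affine groups over prime fields\<close>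

text \<open>
  The group of maps \<open>z \<mapsto> a z + b\<close> of the field with \<open>p\<close> elements, \<open>a \<noteq> 0\<close>, written as pairs \<open>(a, b)\<close>.
\<close>
definition affine_group :: "nat \<Rightarrow> (int \<times> int) monoid" where
  "affine_group p =
    \<lparr>carrier = {1..<int p} \<times> {0..<int p},
     monoid.mult = (\<lambda>(a, b) (a', b'). (a * a' mod int p, (b + a * b') mod int p)),
     one = (1, 0)\<rparr>"

text \<open>
  The multiplicative group of the field with \<open>p\<close> elements, to which the affine group maps with the
  translations as kernel.
\<close>
definition mult_mod :: "nat \<Rightarrow> int monoid" where
  "mult_mod p = \<lparr>carrier = {1..<int p}, monoid.mult = (\<lambda>a a'. a * a' mod int p), one = 1\<rparr>"

lemma mod_mem_units:
  assumes "prime p" "\<not> int p dvd a"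
  shows "a mod int p \<in> {1..<int p}"
proof -
  have "a mod int p \<noteq> 0" using assms by (simp add: mod_eq_0_iff_dvd)
  moreover have "0 \<le> a mod int p" "a mod int p < int p"
    using assms prime_gt_0_nat by simp_all
  ultimately show ?thesis by simp
qed

lemma not_dvd_unit: "a \<in> {1..<int p} \<Longrightarrow> \<not> int p dvd a"
  using zdvd_not_zless by auto

lemma ex_inverse_mod_prime:
  assumes p: "prime p" and a: "a \<in> {1..<int p}"
  shows "\<exists>a'\<in>{1..<int p}. [a' * a = 1] (mod int p)"
proof -
  have "coprime a (int p)"
    using p not_dvd_unit[OF a] by (metis coprime_commute prime_imp_coprime prime_nat_int_transfer)
  then obtain x where x: "[a * x = 1] (mod int p)" using cong_solve_coprime_int by blast
  have "\<not> int p dvd x"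
  proof
    assume "int p dvd x"
    then have "[a * x = 0] (mod int p)" by (simp add: cong_0_iff)
    with x have "[1 = 0] (mod int p)" using cong_sym cong_trans by blast
    then show False using prime_gt_1_nat[OF p] by (simp add: cong_0_iff)
  qed
  then have "x mod int p \<in> {1..<int p}" by (rule mod_mem_units[OF p])
  moreover have "[(x mod int p) * a = 1] (mod int p)"
    using x by (simp add: cong_def mod_simps mult.commute)
  ultimately show ?thesis by blast
qed

lemma mult_mod_closed:
  assumes "prime p" "a \<in> {1..<int p}" "b \<in> {1..<int p}"
  shows "a * b mod int p \<in> {1..<int p}"
  using assms not_dvd_unit[OF assms(2)] not_dvd_unit[OF assms(3)]
  by (intro mod_mem_units) (simp_all add: prime_dvd_mult_iff)

lemma comm_group_mult_mod:
  assumes p: "prime p"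
  shows "comm_group (mult_mod p)"
proof (rule comm_groupI)
  have "int p > 1" using p by (simp add: prime_gt_Suc_0_nat)
  then show "\<one>\<^bsub>mult_mod p\<^esub> \<in> carrier (mult_mod p)" by (simp add: mult_mod_def)
  fix a assume a: "a \<in> carrier (mult_mod p)"
  then show "\<one>\<^bsub>mult_mod p\<^esub> \<otimes>\<^bsub>mult_mod p\<^esub> a = a" by (simp add: mult_mod_def)
  show "\<exists>b\<in>carrier (mult_mod p). b \<otimes>\<^bsub>mult_mod p\<^esub> a = \<one>\<^bsub>mult_mod p\<^esub>"
    using ex_inverse_mod_prime[OF p] a \<open>int p > 1\<close> by (auto simp: mult_mod_def cong_def)
qed (use mult_mod_closed[OF p] in \<open>auto simp: mult_mod_def mod_simps ac_simps\<close>)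

lemma mult_mod_pow:
  assumes p: "prime p" and a: "a \<in> carrier (mult_mod p)"
  shows "a [^]\<^bsub>mult_mod p\<^esub> (p - 1) = \<one>\<^bsub>mult_mod p\<^esub>"
proof -
  interpret comm_group "mult_mod p" by (rule comm_group_mult_mod[OF p])
  have p1: "int p > 1" using p by (simp add: prime_gt_Suc_0_nat)
  have pow: "a [^]\<^bsub>mult_mod p\<^esub> n = a ^ n mod int p" for n
    by (induction n) (use p1 in \<open>simp_all add: mult_mod_def mod_simps ac_simps\<close>)
  have "a \<in> {1..<int p}" using a by (simp add: mult_mod_def)
  then have "\<not> p dvd nat a" "int (nat a) = a"
    using not_dvd_unit by (auto simp: int_dvd_int_iff[symmetric] simp del: int_dvd_int_iff)
  then have "[int (nat a ^ (p - 1)) = int 1] (mod int p)"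
    using fermat_theorem[OF p] cong_int_iff by blast
  then show ?thesis using \<open>int (nat a) = a\<close> p1 by (simp add: pow cong_def) (simp add: mult_mod_def)
qed

lemma group_affine_group:
  assumes p: "prime p"
  shows "group (affine_group p)"
proof (rule groupI)
  have p1: "int p > 1" using p by (simp add: prime_gt_Suc_0_nat)
  then show "\<one>\<^bsub>affine_group p\<^esub> \<in> carrier (affine_group p)" by (simp add: affine_group_def)
  fix x assume x: "x \<in> carrier (affine_group p)"
  then show "\<one>\<^bsub>affine_group p\<^esub> \<otimes>\<^bsub>affine_group p\<^esub> x = x" by (auto simp: affine_group_def)
  obtain a b where ab: "x = (a, b)" "a \<in> {1..<int p}" using x by (auto simp: affine_group_def)
  obtain a' where a': "a' \<in> {1..<int p}" "[a' * a = 1] (mod int p)"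
    using ex_inverse_mod_prime[OF p ab(2)] by blast
  show "\<exists>y\<in>carrier (affine_group p). y \<otimes>\<^bsub>affine_group p\<^esub> x = \<one>\<^bsub>affine_group p\<^esub>"
    using a' p1 ab
    by (intro bexI[of _ "(a', (- (a' * b)) mod int p)"]) (auto simp: affine_group_def cong_def mod_simps)
next
  have mod_affine: "(b + a * (c mod int p)) mod int p = (b + a * c) mod int p" for a b c
    by (metis mod_add_right_eq mod_mult_right_eq)
  fix x y z
  assume *: "x \<in> carrier (affine_group p)" "y \<in> carrier (affine_group p)" "z \<in> carrier (affine_group p)"
  obtain a b a' b' a'' b'' where "x = (a, b)" "y = (a', b')" "z = (a'', b'')"
    by (metis surj_pair)
  moreover have "(b + (a * b' + (a * a' mod int p) * b'')) mod int p = (b + a * (b' + a' * b'')) mod int p"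
    using mod_affine[of "b + a * b'" b'' "a * a'"] by (simp add: algebra_simps)
  ultimately show "x \<otimes>\<^bsub>affine_group p\<^esub> y \<otimes>\<^bsub>affine_group p\<^esub> z =
      x \<otimes>\<^bsub>affine_group p\<^esub> (y \<otimes>\<^bsub>affine_group p\<^esub> z)"
    by (simp add: affine_group_def mod_affine) (simp add: mod_simps ac_simps)
qed (use mult_mod_closed[OF p] p prime_gt_0_nat in \<open>auto simp: affine_group_def\<close>)

section \<open>Affine groups detect net traversals\<close>

text \<open>
  Kronecker's substitution: read the vector as a number in base \<open>L + 1\<close> with digits of absolute value
  at most \<open>L\<close>. If the number is zero, its last digit is divisible by the base and hence zero. The
  induction puts the new coordinate in the last place and shifts the others.
\<close>
lemma ex_separating_weights:
  assumes "finite X"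
  shows "\<exists>k :: 'x \<Rightarrow> nat. \<forall>d :: 'x \<Rightarrow> int.
    (\<forall>x\<in>X. \<bar>d x\<bar> \<le> int L) \<longrightarrow> (\<Sum>x\<in>X. d x * int (k x)) = 0 \<longrightarrow> (\<forall>x\<in>X. d x = 0)"
  using assms
proof induction
  case empty
  then show ?case by simp
next
  case (insert a X)
  then obtain k :: "'x \<Rightarrow> nat" where k: "\<And>d :: 'x \<Rightarrow> int. \<forall>x\<in>X. \<bar>d x\<bar> \<le> int L \<Longrightarrow>
      (\<Sum>x\<in>X. d x * int (k x)) = 0 \<Longrightarrow> \<forall>x\<in>X. d x = 0" by blast
  define k' where "k' x = (if x = a then 1 else Suc L * k x)" for x
  have "\<forall>x\<in>insert a X. d x = 0"
    if d: "\<forall>x\<in>insert a X. \<bar>d x\<bar> \<le> int L" and 0: "(\<Sum>x\<in>insert a X. d x * int (k' x)) = 0"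
    for d :: "'x \<Rightarrow> int"
  proof -
    have "(\<Sum>x\<in>X. d x * int (k' x)) = (\<Sum>x\<in>X. int (Suc L) * (d x * int (k x)))"
      using insert(2) by (intro sum.cong) (auto simp: k'_def algebra_simps)
    then have eq: "d a + int (Suc L) * (\<Sum>x\<in>X. d x * int (k x)) = 0"
      using 0 insert(1,2) by (simp add: k'_def sum_distrib_left)
    then have "int (Suc L) dvd d a" by (metis add_eq_0_iff dvd_minus_iff dvd_triv_left minus_minus)
    then have "d a = 0" using d dvd_imp_le_int[of "d a" "int (Suc L)"] by auto
    moreover have "(\<Sum>x\<in>X. d x * int (k x)) = 0" using eq \<open>d a = 0\<close> by simp
    ultimately show ?thesis using k d by auto
  qed
  then show ?case by blast
qed

text \<open>
  Let each variable \<open>x\<close> act as \<open>z \<mapsto> T ^ k x * z + [x = x0]\<close>. Then the translation part of a word collects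
  \<open>\<plusminus> T ^ E v\<close> for each traversal of an edge \<open>(v, x0)\<close>, where \<open>E\<close> is the linear form with coefficients \<open>k\<close>;
  edges with other labels contribute nothing. The factor \<open>T ^ E v\<close> on the left accounts for a walk that
  starts at \<open>v\<close> instead of the origin; a start far from the origin avoids negative powers of \<open>T\<close>.
\<close>
lemma affine_word_translation:
  fixes k :: "'x \<Rightarrow> nat" and T :: int and x0 :: 'x
  assumes p: "prime p" and T: "\<not> int p dvd T" and X: "finite X"
  defines "E \<equiv> \<lambda>v. \<Sum>y\<in>X. k y * v y"
  defines "f \<equiv> \<lambda>x. (T ^ k x mod int p, of_bool (x = x0))"
  assumes v: "\<And>y. length w \<le> v y" and w: "fst ` set w \<subseteq> X"
  shows "[T ^ E v * snd (word_val (affine_group p) f w) =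
    (\<Sum>q\<leftarrow>steps v w. snd q * (of_bool (snd (fst q) = x0) * T ^ E (fst (fst q))))] (mod int p)"
  using v w
proof (induction v w rule: steps.induct)
  case (1 v)
  then show ?case by (simp add: affine_group_def)
next
  case (2 v x w)
  let ?v = "v(x := Suc (v x))" and ?b = "of_bool (x = x0) :: int"
  have x: "x \<in> X" using 2(3) by auto
  obtain A B where AB: "word_val (affine_group p) f w = (A, B)" by fastforce
  have "length w \<le> ?v y" for y using 2(2)[of y] by auto
  then have IH: "[T ^ E ?v * snd (word_val (affine_group p) f w) =
      (\<Sum>q\<leftarrow>steps ?v w. snd q * (of_bool (snd (fst q) = x0) * T ^ E (fst (fst q))))] (mod int p)"
    by (rule 2(1)) (use 2(3) in auto)
  have rest: "(\<Sum>y\<in>X - {x}. k y * ?v y) = (\<Sum>y\<in>X - {x}. k y * v y)"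
    by (intro sum.cong) auto
  have E: "E ?v = E v + k x"
    unfolding E_def sum.remove[OF X x] by (simp add: rest)
  have "[T ^ E v * ((?b + (T ^ k x mod int p) * B) mod int p) = T ^ E v * (?b + T ^ k x * B)] (mod int p)"
    unfolding cong_def by (metis mod_add_right_eq mod_mult_left_eq mod_mult_right_eq)
  also have "T ^ E v * (?b + T ^ k x * B) = ?b * T ^ E v + T ^ E ?v * B"
    unfolding E power_add by (simp add: algebra_simps)
  also have "[\<dots> = ?b * T ^ E v + (\<Sum>q\<leftarrow>steps ?v w. snd q * (of_bool (snd (fst q) = x0) * T ^ E (fst (fst q))))] (mod int p)"
    using IH by (intro cong_add cong_refl) (simp add: AB)
  finally show ?case using AB by (simp add: affine_group_def f_def)
next
  case (3 v x w)
  let ?v = "v(x := v x - 1)" and ?b = "of_bool (x = x0) :: int" and ?G = "affine_group p"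
  interpret group ?G by (rule group_affine_group[OF p])
  have x: "x \<in> X" using 3(3) by auto
  obtain A B where AB: "word_val ?G f w = (A, B)" by fastforce
  have "length w \<le> ?v y" for y using 3(2)[of y] by auto
  then have IH: "[T ^ E ?v * snd (word_val ?G f w) =
      (\<Sum>q\<leftarrow>steps ?v w. snd q * (of_bool (snd (fst q) = x0) * T ^ E (fst (fst q))))] (mod int p)"
    by (rule 3(1)) (use 3(3) in auto)
  have rest: "(\<Sum>y\<in>X - {x}. k y * ?v y) = (\<Sum>y\<in>X - {x}. k y * v y)"
    by (intro sum.cong) auto
  have E: "E v = E ?v + k x"
    unfolding E_def sum.remove[OF X x] rest using 3(2)[of x] by (cases "v x") simp_all
  have fx: "f x \<in> carrier ?G"
    using mod_mem_units[OF p, of "T ^ k x"] T p prime_gt_1_nat[OF p]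
      prime_dvd_power[of "int p" T "k x"]
    by (auto simp: f_def affine_group_def)
  obtain a' b' where inv: "inv\<^bsub>?G\<^esub> f x = (a', b')" by fastforce
  have "f x \<otimes>\<^bsub>?G\<^esub> inv\<^bsub>?G\<^esub> f x = \<one>\<^bsub>?G\<^esub>" using fx by simp
  then have "(T ^ k x mod int p) * a' mod int p = 1" "(?b + (T ^ k x mod int p) * b') mod int p = 0"
    unfolding inv by (simp_all add: f_def affine_group_def)
  moreover have "(?b + (T ^ k x mod int p) * b') mod int p = (?b + T ^ k x * b') mod int p"
    by (intro mod_add_cong refl mod_mult_left_eq)
  ultimately have a': "[T ^ k x * a' = 1] (mod int p)" and b': "[?b + T ^ k x * b' = 0] (mod int p)"
    using prime_gt_1_nat[OF p] by (simp_all add: cong_def mod_mult_left_eq)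
  have "[T ^ E v * ((b' + a' * B) mod int p) = T ^ E v * (b' + a' * B)] (mod int p)"
    by (intro cong_mult cong_refl) simp
  also have "T ^ E v * (b' + a' * B) = T ^ E ?v * ((?b + T ^ k x * b') - ?b + (T ^ k x * a') * B)"
    unfolding E power_add by (simp add: algebra_simps)
  also have "[\<dots> = T ^ E ?v * (0 - ?b + 1 * B)] (mod int p)"
    by (intro cong_mult cong_add cong_diff cong_refl a' b')
  also have "T ^ E ?v * (0 - ?b + 1 * B) = - ?b * T ^ E ?v + T ^ E ?v * B"
    by (simp add: algebra_simps)
  also have "[\<dots> = - ?b * T ^ E ?v + (\<Sum>q\<leftarrow>steps ?v w. snd q * (of_bool (snd (fst q) = x0) * T ^ E (fst (fst q))))] (mod int p)"
    using IH by (intro cong_add cong_refl) (simp add: AB)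
  finally show ?case using AB inv by (simp add: affine_group_def)
qed

lemma steps_vertex:
  assumes "q \<in> set (steps v w)"
  shows "fst (fst q) y \<le> v y + length w" "y \<notin> fst ` set w \<Longrightarrow> fst (fst q) y = v y"
proof -
  have "fst (fst q) y \<le> v y + length w \<and> (y \<notin> fst ` set w \<longrightarrow> fst (fst q) y = v y)"
    using assms
  proof (induction v w rule: steps.induct)
    case (2 v x w)
    from 2(2) consider "q = ((v, x), 1)" | "q \<in> set (steps (v(x := Suc (v x))) w)" by auto
    then show ?case
    proof cases
      assume "q \<in> set (steps (v(x := Suc (v x))) w)"
      then have "fst (fst q) y \<le> (v(x := Suc (v x))) y + length w \<and>
          (y \<notin> fst ` set w \<longrightarrow> fst (fst q) y = (v(x := Suc (v x))) y)" by (rule 2(1))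
      then show ?thesis by (auto split: if_splits)
    qed auto
  next
    case (3 v x w)
    from 3(2) consider "q = ((v(x := v x - 1), x), - 1)" | "q \<in> set (steps (v(x := v x - 1)) w)" by auto
    then show ?case
    proof cases
      assume "q \<in> set (steps (v(x := v x - 1)) w)"
      then have "fst (fst q) y \<le> (v(x := v x - 1)) y + length w \<and>
          (y \<notin> fst ` set w \<longrightarrow> fst (fst q) y = (v(x := v x - 1)) y)" by (rule 3(1))
      then show ?thesis by (auto split: if_splits)
    qed auto
  qed simp
  then show "fst (fst q) y \<le> v y + length w" "y \<notin> fst ` set w \<Longrightarrow> fst (fst q) y = v y" by auto
qed

text \<open>
  For a fixed label \<open>x0\<close>, \<open>affine_word_translation\<close> turns the net traversals into the coefficients of a
  polynomial \<open>P\<close> with \<open>P(T)\<close> divisible by every large prime, whatever the positive integer \<open>T\<close> is. So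
  \<open>P\<close> has infinitely many roots and vanishes. With separating weights \<open>k\<close> different vertices of the walk
  have different exponents, hence each net traversal is itself a coefficient of \<open>P\<close>.
\<close>
lemma net_zero_if_affine_trivial:
  fixes w :: "'x gword"
  assumes triv: "\<And>p f. prime p \<Longrightarrow> range f \<subseteq> carrier (affine_group p) \<Longrightarrow>
    word_val (affine_group p) f w = \<one>\<^bsub>affine_group p\<^esub>"
    and v: "\<And>y. length w \<le> v y" and bound: "\<And>y. v y \<le> L"
  shows "net (steps v w) e = 0"
proof -
  obtain u x0 where e: "e = (u, x0)" by fastforce
  define X where "X = fst ` set w"
  define ps where "ps = steps v w"
  have X: "finite X" by (simp add: X_def)
  obtain k :: "'x \<Rightarrow> nat" where k: "\<And>d :: 'x \<Rightarrow> int. \<forall>x\<in>X. \<bar>d x\<bar> \<le> int (L + length w) \<Longrightarrow>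
      (\<Sum>x\<in>X. d x * int (k x)) = 0 \<Longrightarrow> \<forall>x\<in>X. d x = 0"
    using ex_separating_weights[OF X] by blast
  define E where "E v = (\<Sum>y\<in>X. k y * v y)" for v
  define P where "P = (\<Sum>q\<leftarrow>ps. monom (snd q * of_bool (snd (fst q) = x0)) (E (fst (fst q))))"
  have poly_P: "poly P T = (\<Sum>q\<leftarrow>ps. snd q * (of_bool (snd (fst q) = x0) * T ^ E (fst (fst q))))" for T
    unfolding P_def by (induction ps) (simp_all add: poly_monom)
  \<comment> \<open>A prime beyond both \<open>T\<close> and \<open>\<bar>P(T)\<bar>\<close>: then \<open>T\<close> is invertible, and divisibility forces \<open>P(T) = 0\<close>.\<close>
  have "poly P (int T) = 0" if T: "T > 0" for T
  proof -
    obtain p where p: "prime p" "max T (nat \<bar>poly P (int T)\<bar>) < p" using bigger_prime by blast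
    have nd: "\<not> int p dvd int T" using p T by (simp add: nat_dvd_not_less)
    have nd': "\<not> int p dvd int T ^ n" for n
      using nd p(1) prime_dvd_power[of "int p" "int T" n] by auto
    define f where "f x = (int T ^ k x mod int p, of_bool (x = x0) :: int)" for x
    have "range f \<subseteq> carrier (affine_group p)"
      using mod_mem_units[OF p(1) nd'] prime_gt_1_nat[OF p(1)]
      by (auto simp: f_def affine_group_def)
    then have "word_val (affine_group p) f w = (1, 0)"
      using triv[OF p(1)] by (simp add: affine_group_def)
    moreover have "[int T ^ E v * snd (word_val (affine_group p) f w) = poly P (int T)] (mod int p)"
      unfolding f_def E_def poly_P ps_def
      by (rule affine_word_translation[OF p(1) nd X v]) (simp add: X_def)
    ultimately have "[0 = poly P (int T)] (mod int p)" by simp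
    then have "int p dvd poly P (int T)" using cong_sym cong_0_iff by blast
    then show ?thesis using p(2) dvd_imp_le_int[of "poly P (int T)" "int p"]
      by (auto simp: nat_less_iff)
  qed
  then have "int ` {0<..} \<subseteq> {T. poly P T = 0}" by auto
  then have "infinite {T. poly P T = 0}"
    using infinite_Ioi[of "0::nat"] finite_imageD[of int "{0<..}"] finite_subset by (metis inj_on_of_nat)
  then have "P = 0" using poly_roots_finite by blast
  show ?thesis
  proof (cases "e \<in> fst ` set ps")
    case False
    then have "filter (\<lambda>q. fst q = e) ps = []" by (auto simp: filter_empty_conv)
    then show ?thesis unfolding net_def ps_def by simp
  next
    case True
    then obtain q0 where q0: "q0 \<in> set ps" "fst q0 = (u, x0)" using e by auto
    have E_inj: "fst (fst q) = u" if q: "q \<in> set ps" and eq: "E (fst (fst q)) = E u" for q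
    proof
      fix y
      let ?d = "\<lambda>y. int (fst (fst q) y) - int (u y)"
      have bd: "fst (fst q) y \<le> L + length w" "u y \<le> L + length w" for y
        using steps_vertex(1)[of q v w y] steps_vertex(1)[of q0 v w y] q q0 bound[of y]
        by (auto simp: ps_def)
      have "\<bar>?d y\<bar> \<le> int (L + length w)" for y
        using bd[of y] by linarith
      moreover have "(\<Sum>y\<in>X. ?d y * int (k y)) = int (E (fst (fst q))) - int (E u)"
        by (simp add: E_def algebra_simps sum_subtractf)
      ultimately have "\<forall>y\<in>X. ?d y = 0" using eq by (intro k) simp_all
      then have "y \<in> X \<Longrightarrow> ?d y = 0" by blast
      moreover have "y \<notin> X \<Longrightarrow> ?d y = 0"
        using steps_vertex(2)[of q v w y] steps_vertex(2)[of q0 v w y] q q0 by (auto simp: ps_def X_def)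
      ultimately have "?d y = 0" by blast
      then show "fst (fst q) y = u y" by linarith
    qed
    have "coeff P (E u) = (\<Sum>q\<leftarrow>ps. if snd (fst q) = x0 \<and> E (fst (fst q)) = E u then snd q else 0)"
      unfolding P_def by (induction ps) auto
    also have "\<dots> = (\<Sum>q\<leftarrow>ps. if fst q = e then snd q else 0)"
      using E_inj e by (intro arg_cong[where f = sum_list] map_cong refl) (auto simp: prod_eq_iff)
    also have "\<dots> = net ps e" unfolding net_def by (induction ps) auto
    finally show ?thesis using \<open>P = 0\<close> by (simp add: ps_def)
  qed
qed

section \<open>Metabelian groups form a variety\<close>

lemma metabelian_iff:
  "G \<in> metabelian_groups \<longleftrightarrow> group G \<and>
    (\<forall>x\<in>derived G (carrier G). \<forall>y\<in>derived G (carrier G). x \<otimes>\<^bsub>G\<^esub> y = y \<otimes>\<^bsub>G\<^esub> x)"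
proof (cases "group G")
  case True
  interpret group G by fact
  have "group (G\<lparr>carrier := derived G (carrier G)\<rparr>)"
    using derived_is_subgroup[of "carrier G"] by (simp add: subgroup_imp_group)
  then show ?thesis
    using True comm_groupE(4)[of "G\<lparr>carrier := derived G (carrier G)\<rparr>"]
    by (auto simp: metabelian_groups_def intro!: group.group_comm_groupI)
qed (simp add: metabelian_groups_def)

lemma (in group_hom) hom_derived:
  assumes "x \<in> derived G (carrier G)"
  shows "h x \<in> derived H (carrier H)"
proof -
  have "h x \<in> derived H (h ` carrier G)" using assms derived_img[of "carrier G"] by auto
  moreover have "h ` carrier G \<subseteq> carrier H" by auto
  ultimately show ?thesis using H.mono_derived[of "h ` carrier G" "carrier H"] by auto
qed

lemma metabelian_epi_image:
  assumes G: "G \<in> metabelian_groups" and H: "group H" and h: "h \<in> epi G H"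
  shows "H \<in> metabelian_groups"
proof -
  interpret group_hom G H h
    using G H h by (simp add: group_hom_def group_hom_axioms_def epi_def metabelian_iff)
  have D: "derived H (carrier H) = h ` derived G (carrier G)"
    using derived_img[of "carrier G"] h by (simp add: epi_def)
  have "derived G (carrier G) \<subseteq> carrier G" by (simp add: G.derived_in_carrier)
  then show ?thesis
    using G H unfolding metabelian_iff D by (auto simp flip: hom_mult simp: subset_iff)
qed

text \<open>
  Homomorphisms map derived subgroups into derived subgroups, so commutation can be tested in the
  targets. Inclusions of subgroups and projections of products are both instances.
\<close>
lemma metabelian_if_separated:
  assumes G: "group G"
    and hom: "\<And>i. i \<in> I \<Longrightarrow> h i \<in> hom G (F i) \<and> F i \<in> metabelian_groups"
    and sep: "\<And>x y. x \<in> carrier G \<Longrightarrow> y \<in> carrier G \<Longrightarrow> (\<And>i. i \<in> I \<Longrightarrow> h i x = h i y) \<Longrightarrow> x = y"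
  shows "G \<in> metabelian_groups"
  unfolding metabelian_iff
proof (intro conjI ballI G)
  interpret group G by fact
  fix x y assume xy: "x \<in> derived G (carrier G)" "y \<in> derived G (carrier G)"
  then have "x \<in> carrier G" "y \<in> carrier G" using derived_in_carrier by auto
  then show "x \<otimes>\<^bsub>G\<^esub> y = y \<otimes>\<^bsub>G\<^esub> x"
  proof (intro sep)
    fix i assume i: "i \<in> I"
    then interpret group_hom G "F i" "h i"
      using hom by (simp add: group_hom_def group_hom_axioms_def metabelian_iff G)
    show "h i (x \<otimes>\<^bsub>G\<^esub> y) = h i (y \<otimes>\<^bsub>G\<^esub> x)"
      using hom[OF i] hom_derived[OF xy(1)] hom_derived[OF xy(2)] \<open>x \<in> carrier G\<close> \<open>y \<in> carrier G\<close>
      by (simp add: metabelian_iff)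
  qed simp_all
qed

lemma metabelian_subgroup:
  assumes "G \<in> metabelian_groups" "subgroup S G"
  shows "G\<lparr>carrier := S\<rparr> \<in> metabelian_groups"
  using assms subgroup.subset[OF assms(2)]
  by (intro metabelian_if_separated[where I = "{()}" and h = "\<lambda>_ x. x" and F = "\<lambda>_. G"])
     (auto simp: metabelian_iff hom_def group.subgroup_imp_group)

lemma metabelian_product:
  assumes "F ` I \<subseteq> metabelian_groups"
  shows "product_group I F \<in> metabelian_groups"
proof (rule metabelian_if_separated)
  show "group (product_group I F)" using assms by (intro product_group) (auto simp: metabelian_iff)
  show "(\<lambda>x. x i) \<in> hom (product_group I F) (F i) \<and> F i \<in> metabelian_groups" if "i \<in> I" for i
    using that assms by (auto simp: hom_def)
  show "x = y" if "x \<in> carrier (product_group I F)" "y \<in> carrier (product_group I F)"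
      "\<And>i. i \<in> I \<Longrightarrow> x i = y i" for x y
    using that by (auto intro: PiE_ext)
qed

lemma metabelian_iso:
  assumes "G \<in> metabelian_groups" "group H" "G \<cong> H"
  shows "H \<in> metabelian_groups"
  using assms metabelian_epi_image[of G H] by (auto simp: is_iso_def iso_iff_mon_epi)

lemma variety_metabelian: "variety (metabelian_groups :: 'u monoid set)"
  unfolding variety_def
proof (intro conjI)
  show "\<forall>G\<in>metabelian_groups :: 'u monoid set. group G"
    by (simp add: metabelian_iff)
  show "closed_under_subgroups (metabelian_groups :: 'u monoid set)"
    unfolding closed_under_subgroups_def by (intro ballI allI impI metabelian_subgroup)
  show "closed_under_images (metabelian_groups :: 'u monoid set)"
    unfolding closed_under_images_def using metabelian_epi_image by metis
  show "closed_under_products (metabelian_groups :: 'u monoid set)"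
    unfolding closed_under_products_def using metabelian_iso metabelian_product by metis
qed

lemma pseudovariety_finite_metabelian:
  "pseudovariety ({G. group G \<and> finite (carrier G)} \<inter> metabelian_groups :: 'u monoid set)"
  (is "pseudovariety (?F \<inter> ?M)")
  unfolding pseudovariety_def
proof (intro conjI)
  have F: "pseudovariety ?F" by (rule pseudovariety_finite_groups)
  have M: "variety ?M" by (rule variety_metabelian)
  show "\<forall>G\<in>?F \<inter> ?M. group G \<and> finite (carrier G)" by blast
  show "closed_under_subgroups (?F \<inter> ?M)"
    using F M unfolding pseudovariety_def variety_def closed_under_subgroups_def by blast
  show "closed_under_images (?F \<inter> ?M)"
    using F M unfolding pseudovariety_def variety_def closed_under_images_def by blast
  show "closed_under_finite_products (?F \<inter> ?M)"
    unfolding closed_under_finite_products_def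
  proof (intro allI impI IntI)
    fix I :: "nat set" and X and H :: "'u monoid"
    assume *: "finite I \<and> X ` I \<subseteq> ?F \<inter> ?M \<and> group H \<and> product_group I X \<cong> H"
    then have XF: "X ` I \<subseteq> ?F" and XM: "X ` I \<subseteq> ?M" by blast+
    have H: "group H" and iso: "product_group I X \<cong> H" and fin: "finite I" using * by simp_all
    have "closed_under_finite_products ?F" by (rule F[unfolded pseudovariety_def, THEN conjunct2, THEN conjunct2, THEN conjunct2])
    note this[unfolded closed_under_finite_products_def, THEN spec[of _ I], THEN spec[of _ X], THEN spec[of _ H], THEN mp]
    then show "H \<in> ?F" using fin XF H iso by blast
    show "H \<in> ?M" by (rule metabelian_iso[OF metabelian_product[OF XM] H iso])
  qed
qed

lemma pv_extensionE:
  assumes "G \<in> pv_extension V W"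
  obtains N where "group G" "finite (carrier G)" "N \<lhd> G" "G\<lparr>carrier := N\<rparr> \<in> V" "G Mod N \<in> copies W"
  using assms unfolding pv_extension_def mem_Collect_eq by (elim conjE exE) (rule that)

text \<open>
  An abelian quotient kills the derived subgroup, which therefore lies in the abelian normal subgroup.
\<close>
lemma pv_extension_Ab_metabelian:
  fixes G :: "'u monoid"
  assumes "G \<in> pv_extension (Ab m) (Ab n)"
  shows "G \<in> metabelian_groups"
proof -
  obtain N where G: "group G" and "finite (carrier G)"
    and N: "N \<lhd> G" "G\<lparr>carrier := N\<rparr> \<in> Ab m" "G Mod N \<in> copies (Ab n :: 'u monoid set)"
    using assms by (rule pv_extensionE)
  obtain Q :: "'u monoid" where Q: "comm_group Q" "G Mod N \<cong> Q"
    using N(3) unfolding copies_def Ab_def by blast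
  have N_comm: "comm_group (G\<lparr>carrier := N\<rparr>)"
    using N(2) unfolding Ab_def by blast
  interpret normal N G by (rule N(1))
  obtain i where i: "i \<in> iso (G Mod N) Q" using Q by (auto simp: is_iso_def)
  interpret i: group_hom "G Mod N" Q i
    using Q i factorgroup_is_group by (simp add: group_hom_def group_hom_axioms_def iso_def comm_group_def)
  interpret group_hom G "G Mod N" "(#>\<^bsub>G\<^esub>) N"
    using G factorgroup_is_group r_coset_hom_Mod by (simp add: group_hom_def group_hom_axioms_def)
  have "x \<in> N" if x: "x \<in> derived G (carrier G)" for x
  proof -
    have xG: "x \<in> carrier G" using x derived_in_carrier by auto
    have "i (N #>\<^bsub>G\<^esub> x) \<in> derived Q (carrier Q)" using x by (intro i.hom_derived hom_derived)
    then have "i (N #>\<^bsub>G\<^esub> x) = \<one>\<^bsub>Q\<^esub>"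
      using comm_group.derived_eq_singleton[OF Q(1), of "carrier Q"] by simp
    then have "i (N #>\<^bsub>G\<^esub> x) = i \<one>\<^bsub>G Mod N\<^esub>" by (simp only: i.hom_one)
    moreover have "inj_on i (carrier (G Mod N))" using i by (simp add: iso_def bij_betw_def)
    ultimately have "N #>\<^bsub>G\<^esub> x = \<one>\<^bsub>G Mod N\<^esub>"
      using xG hom_closed i.G.one_closed by (metis inj_onD)
    then have "N #>\<^bsub>G\<^esub> x = N" by (simp add: FactGroup_def)
    then show ?thesis using xG rcos_self[OF xG subgroup_axioms] by simp
  qed
  then show ?thesis
    using G comm_groupE(4)[OF N_comm] by (simp add: metabelian_iff)
qed

lemma U_class_metabelian: "(U_class :: 'u monoid set) \<subseteq> metabelian_groups"
proof -
  let ?P = "{G. group G \<and> finite (carrier G)} \<inter> metabelian_groups :: 'u monoid set"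
  have "pv_extension (Ab p) (Ab (p - 1)) \<subseteq> ?P" for p
  proof
    fix G :: "'u monoid" assume G: "G \<in> pv_extension (Ab p) (Ab (p - 1))"
    then show "G \<in> ?P" using pv_extension_Ab_metabelian[OF G] by (elim pv_extensionE) simp
  qed
  then have "U_class \<subseteq> ?P"
    using pseudovariety_finite_metabelian unfolding U_class_def pseudovariety_join_def by blast
  then show ?thesis by blast
qed

section \<open>Affine groups belong to the pseudovariety\<close>

lemma ex_group_on_image:
  fixes G :: "('a, 'm) monoid_scheme" and i :: "'a \<Rightarrow> 'b"
  assumes G: "group G" and i: "inj_on i (carrier G)"
  obtains H :: "'b monoid" where "group H" "i \<in> iso G H" "carrier H = i ` carrier G"
proof -
  have iso: "i \<in> iso G (image_group i G)"
    using i by (auto simp: iso_def hom_def image_group_def bij_betw_def monoid.m_closed group.is_monoid[OF G])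
  have "group (image_group i G)"
    using group.iso_imp_img_group[OF G iso] by (simp add: image_group_def)
  then show ?thesis using iso by (rule that) (simp add: image_group_def)
qed

text \<open>
  The quotient of \<open>G\<close> must be isomorphic to a group over the element type of \<open>G\<close>. As \<open>Q\<close> is finite, it
  can be carried over to any infinite type.
\<close>
lemma pv_extension_AbI:
  fixes G :: "'u monoid"
  assumes inf: "infinite (UNIV :: 'u set)" and G: "group G" "finite (carrier G)"
    and h: "h \<in> epi G Q" and Q: "comm_group Q" "\<And>x. x \<in> carrier Q \<Longrightarrow> x [^]\<^bsub>Q\<^esub> n = \<one>\<^bsub>Q\<^esub>"
    and ker_comm: "\<And>x y. x \<in> kernel G Q h \<Longrightarrow> y \<in> kernel G Q h \<Longrightarrow> x \<otimes>\<^bsub>G\<^esub> y = y \<otimes>\<^bsub>G\<^esub> x"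
    and ker_pow: "\<And>x. x \<in> kernel G Q h \<Longrightarrow> x [^]\<^bsub>G\<^esub> m = \<one>\<^bsub>G\<^esub>"
  shows "G \<in> pv_extension (Ab m) (Ab n)"
proof -
  interpret Q: comm_group Q by fact
  interpret group_hom G Q h
    using G h by (simp add: group_hom_def group_hom_axioms_def epi_def Q.group_axioms)
  let ?N = "kernel G Q h"
  have onto: "h ` carrier G = carrier Q" using h by (simp add: epi_def)
  have "finite (carrier Q)" using onto G(2) by (metis finite_imageI)
  moreover obtain B :: "'u set" where "finite B" "card B = card (carrier Q)"
    using infinite_arbitrarily_large[OF inf] by blast
  ultimately obtain i :: "_ \<Rightarrow> 'u" where i: "inj_on i (carrier Q)"
    using finite_same_card_bij[of "carrier Q" B] unfolding bij_betw_def by metis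
  obtain R :: "'u monoid" where R: "group R" "i \<in> iso Q R" and "carrier R = i ` carrier Q"
    by (rule ex_group_on_image[OF Q.group_axioms i])
  then have iR: "i ` carrier Q = carrier R" by simp
  interpret i: group_hom Q R i
    using R by (simp add: group_hom_def group_hom_axioms_def iso_def Q.group_axioms)
  have "R \<in> Ab n"
    unfolding Ab_def
  proof (intro CollectI conjI ballI)
    show "finite (carrier R)" using iR \<open>finite (carrier Q)\<close> by (metis finite_imageI)
    show "comm_group R"
      using R(1) iR Q.m_comm by (intro group.group_comm_groupI) (auto simp flip: iR i.hom_mult)
    show "x [^]\<^bsub>R\<^esub> n = \<one>\<^bsub>R\<^esub>" if "x \<in> carrier R" for x
      using that Q(2) i.hom_nat_pow iR by (metis i.hom_one imageE)
  qed
  moreover have "G Mod ?N \<cong> R"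
    using FactGroup_iso[OF onto] R(2) iso_trans is_isoI by blast
  ultimately have "G Mod ?N \<in> copies (Ab n :: 'u monoid set)"
    using normal.factorgroup_is_group[OF normal_kernel] by (auto simp: copies_def)
  moreover have "G\<lparr>carrier := ?N\<rparr> \<in> Ab m"
  proof -
    have "group (G\<lparr>carrier := ?N\<rparr>)" using subgroup_kernel by (rule G.subgroup_imp_group)
    moreover have "x [^]\<^bsub>G\<lparr>carrier := ?N\<rparr>\<^esub> m = \<one>\<^bsub>G\<^esub>" if "x \<in> ?N" for x
      using that ker_pow G.nat_pow_consistent by metis
    moreover have "finite ?N" using G(2) by (simp add: kernel_def)
    ultimately show ?thesis
      using ker_comm by (auto simp: Ab_def intro!: group.group_comm_groupI)
  qed
  ultimately show ?thesis
    using G normal_kernel unfolding pv_extension_def by blast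
qed

text \<open>
  The translations form a normal subgroup of exponent \<open>p\<close>, and the quotient by them is the
  multiplicative group, whose exponent divides \<open>p - 1\<close> by Fermat's theorem.
\<close>
lemma affine_copy_in_pv_extension:
  fixes C :: "'u monoid"
  assumes inf: "infinite (UNIV :: 'u set)" and p: "prime p"
    and C: "group C" and j: "j \<in> iso (affine_group p) C"
  shows "C \<in> pv_extension (Ab p) (Ab (p - 1))"
proof -
  let ?A = "affine_group p"
  have p1: "int p > 1" using prime_gt_1_nat[OF p] by simp
  obtain i where i: "i \<in> iso C ?A"
    using group.iso_set_sym[OF group_affine_group[OF p] j] by blast
  interpret A: group ?A by (rule group_affine_group[OF p])
  interpret i: group_hom C ?A i
    using C i by (simp add: group_hom_def group_hom_axioms_def iso_def A.group_axioms)
  have inj: "inj_on i (carrier C)" and surj: "i ` carrier C = carrier ?A"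
    using i by (simp_all add: iso_def bij_betw_def)
  have fst: "fst \<in> epi ?A (mult_mod p)"
    using p1 by (force simp: epi_iff_subset hom_def affine_group_def mult_mod_def image_iff)
  show ?thesis
  proof (rule pv_extension_AbI[OF inf C])
    have "finite (carrier ?A)" by (simp add: affine_group_def)
    then show "finite (carrier C)" using finite_imageD[OF _ inj] surj by simp
    show "fst \<circ> i \<in> epi C (mult_mod p)"
      using i fst by (intro epi_compose) (auto simp: iso_iff_mon_epi)
    show "comm_group (mult_mod p)" by (rule comm_group_mult_mod[OF p])
    show "x [^]\<^bsub>mult_mod p\<^esub> (p - 1) = \<one>\<^bsub>mult_mod p\<^esub>" if "x \<in> carrier (mult_mod p)" for x
      using mult_mod_pow[OF p that] .
    have K: "x \<in> carrier C \<and> (\<exists>b\<in>{0..<int p}. i x = (1, b))" if "x \<in> kernel C (mult_mod p) (fst \<circ> i)" for x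
    proof -
      have "i x \<in> carrier ?A" using that by (simp add: kernel_def)
      then show ?thesis using that by (cases "i x") (auto simp: kernel_def mult_mod_def affine_group_def)
    qed
    show "x \<otimes>\<^bsub>C\<^esub> y = y \<otimes>\<^bsub>C\<^esub> x"
      if "x \<in> kernel C (mult_mod p) (fst \<circ> i)" "y \<in> kernel C (mult_mod p) (fst \<circ> i)" for x y
      using K[OF that(1)] K[OF that(2)]
      by (intro inj_onD[OF inj]) (auto simp: affine_group_def add.commute)
    show "x [^]\<^bsub>C\<^esub> p = \<one>\<^bsub>C\<^esub>" if ker: "x \<in> kernel C (mult_mod p) (fst \<circ> i)" for x
    proof (rule inj_onD[OF inj])
      obtain b where x: "x \<in> carrier C" "i x = (1, b)" using K[OF ker] by blast
      have "(1, b) [^]\<^bsub>?A\<^esub> n = (1, int n * b mod int p)" for n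
        by (induction n) (use p1 in \<open>simp_all add: affine_group_def mod_simps algebra_simps\<close>)
      then show "i (x [^]\<^bsub>C\<^esub> p) = i \<one>\<^bsub>C\<^esub>"
        using x by (simp add: i.hom_nat_pow) (simp add: affine_group_def)
      show "x [^]\<^bsub>C\<^esub> p \<in> carrier C" using x by simp
    qed simp
  qed
qed

lemma affine_copy_in_U_class:
  fixes C :: "'u monoid"
  assumes inf: "infinite (UNIV :: 'u set)" and p: "prime p"
    and C: "group C" and j: "j \<in> iso (affine_group p) C"
  shows "C \<in> U_class"
  using affine_copy_in_pv_extension[OF assms] p unfolding U_class_def pseudovariety_join_def by blast

section \<open>The generated variety\<close>

lemma metabelian_satisfies_affine_laws:
  assumes G: "G \<in> metabelian_groups" and f: "range f \<subseteq> carrier G"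
    and triv: "\<And>p a. prime p \<Longrightarrow> range a \<subseteq> carrier (affine_group p) \<Longrightarrow>
      word_val (affine_group p) a w = \<one>\<^bsub>affine_group p\<^esub>"
  shows "word_val G f w = \<one>\<^bsub>G\<^esub>"
proof -
  let ?D = "derived G (carrier G)"
  interpret group G using G by (simp add: metabelian_iff)
  interpret D: normal ?D G by (rule derived_self_is_normal)
  interpret h: group_hom G "G Mod ?D" "(#>\<^bsub>G\<^esub>) ?D"
    using D.factorgroup_is_group D.r_coset_hom_Mod by (simp add: group_hom_def group_hom_axioms_def is_group)
  have "x \<in> ?D" if "x \<in> kernel G (G Mod ?D) ((#>\<^bsub>G\<^esub>) ?D)" for x
    using that rcos_self[OF _ D.subgroup_axioms, of x] by (simp add: kernel_def FactGroup_def)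
  then have "comm_group (G\<lparr>carrier := kernel G (G Mod ?D) ((#>\<^bsub>G\<^esub>) ?D)\<rparr>)"
    using G subgroup_imp_group[OF h.subgroup_kernel]
    by (intro group.group_comm_groupI) (simp_all add: metabelian_iff)
  moreover have "((#>\<^bsub>G\<^esub>) ?D) ` carrier G = carrier (G Mod ?D)"
    by (auto simp: FactGroup_def RCOSETS_def)
  (* A start from which no coordinate of the walk can become negative. *)
  moreover have "net (steps (\<lambda>_. length w) w) e = 0" for e
    by (rule net_zero_if_affine_trivial[OF triv]) auto
  ultimately show ?thesis
    using h.word_trivial_if_net_zero[OF derived_quot_is_comm_group _ _ f, of w "\<lambda>_. length w"] by blast
qed

text \<open>
  A word over an infinite alphabet with a pairing function is coded by nested pairs; together with its
  length the code determines the word. The pairing exists as infinite cardinals are idempotent.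
\<close>
lemma ex_inj_words:
  obtains j :: "'a gword \<times> nat \<Rightarrow> 'a + nat" where "inj j"
proof -
  have "infinite (UNIV :: ('a + nat) set)" by (simp add: finite_Plus_UNIV_iff)
  then have "\<exists>f :: ('a + nat) \<times> ('a + nat) \<Rightarrow> 'a + nat. inj_on f (UNIV \<times> UNIV) \<and> f ` (UNIV \<times> UNIV) \<subseteq> UNIV"
    unfolding card_of_ordLeq by (intro ordIso_imp_ordLeq card_of_Times_same_infinite)
  then obtain f :: "('a + nat) \<times> ('a + nat) \<Rightarrow> 'a + nat" where f: "inj f" by auto
  define l where "l = (\<lambda>(x :: 'a, b :: bool). f (Inl x, Inr (of_bool b)))"
  define c where "c = (\<lambda>w. foldr (\<lambda>a s. f (l a, s)) w (Inr 0))"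
  have l: "l a = l b \<longleftrightarrow> a = b" for a b
    using f by (cases a; cases b) (auto simp: l_def inj_eq split: if_splits)
  have c: "u = w" if "length u = length w" "c u = c w" for u w
    using that
    by (induction u w rule: list_induct2) (auto simp: c_def inj_eq[OF f] l)
  have "inj (\<lambda>(w, n). f (Inr n, f (Inr (length w), c w)))"
    using c by (auto simp: inj_def inj_eq[OF f])
  then show ?thesis by (rule that)
qed

text \<open>
  For each word \<open>w\<close> that is nontrivial at the elements of \<open>G\<close>, take an affine group and an assignment
  \<open>a w\<close> of the variables at which \<open>w\<close> is nontrivial too; for other words any choice will do. In the product \<open>P\<close> of these groups over all
  words, a word that is trivial at the tuple of all assignments is trivial in \<open>G\<close>; thus \<open>G\<close> is an image
  of a subgroup of \<open>P\<close>. The rest is to find room for \<open>P\<close>: the factors get countable carriers, so a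
  member of \<open>P\<close> is a map from words to natural numbers, and its graph is a subset of a set of the
  size of \<open>'a + nat\<close>.
\<close>
lemma metabelian_copy_in_variety:
  fixes G :: "'a monoid" and H :: "'u monoid" and e :: "('a + nat) set \<Rightarrow> 'u"
  assumes e: "inj e" and K: "variety K" "U_class \<subseteq> K"
    and G: "G \<in> metabelian_groups" and H: "group H" "G \<cong> H"
  shows "H \<in> K"
proof -
  interpret G: group G using G by (simp add: metabelian_iff)
  obtain j :: "'a gword \<times> nat \<Rightarrow> 'a + nat" where j: "inj j" by (rule ex_inj_words)
  define y where "y g = (if g \<in> carrier G then g else \<one>\<^bsub>G\<^esub>)" for g
  have y: "range y = carrier G" by (auto simp: y_def)
  define \<nu> :: "nat \<Rightarrow> 'u" where "\<nu> n = e {Inr n}" for n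
  have \<nu>: "inj \<nu>" using e by (auto simp: \<nu>_def inj_def)
  then have inf: "infinite (UNIV :: 'u set)" by (metis finite_imageD finite_subset infinite_UNIV_nat top_greatest)
  define \<iota> :: "'a gword \<Rightarrow> 'u" where "\<iota> w = e {j (w, 0)}" for w
  have \<iota>: "inj \<iota>" by (intro injI) (simp add: \<iota>_def inj_eq[OF e] inj_eq[OF j])
  define code :: "int \<times> int \<Rightarrow> 'u" where "code = \<nu> \<circ> to_nat"
  have code: "inj code" unfolding code_def using \<nu> by (intro inj_compose) auto

  have "\<exists>C :: 'u monoid. prime p \<longrightarrow> group C \<and> code \<in> iso (affine_group p) C \<and>
      carrier C = code ` carrier (affine_group p)" for p
    using ex_group_on_image[OF group_affine_group inj_on_subset[OF code subset_UNIV]] by metis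
  then have "\<exists>C :: nat \<Rightarrow> 'u monoid. \<forall>p. prime p \<longrightarrow> group (C p) \<and> code \<in> iso (affine_group p) (C p) \<and>
      carrier (C p) = code ` carrier (affine_group p)"
    by (intro choice allI)
  then obtain C :: "nat \<Rightarrow> 'u monoid" where C: "group (C p)" "code \<in> iso (affine_group p) (C p)"
      "carrier (C p) = code ` carrier (affine_group p)" if "prime p" for p
    by blast
  have "\<exists>p a. prime p \<and> range a \<subseteq> carrier (affine_group p) \<and>
      (word_val (affine_group p) a w = \<one>\<^bsub>affine_group p\<^esub> \<longrightarrow> word_val G y w = \<one>\<^bsub>G\<^esub>)" for w
  proof (cases "word_val G y w = \<one>\<^bsub>G\<^esub>")
    case True
    have "range (\<lambda>_. \<one>\<^bsub>affine_group 2\<^esub>) \<subseteq> carrier (affine_group 2)"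
      by (auto simp: affine_group_def)
    then show ?thesis using True two_is_prime_nat by blast
  next
    case False
    then show ?thesis using metabelian_satisfies_affine_laws[OF G, of y w] y by blast
  qed
  then obtain p a where p: "prime (p w)" and a: "range (a w) \<subseteq> carrier (affine_group (p w))"
    and sep: "word_val (affine_group (p w)) (a w) w = \<one>\<^bsub>affine_group (p w)\<^esub> \<Longrightarrow> word_val G y w = \<one>\<^bsub>G\<^esub>" for w
    by metis

  define F where "F u = C (p (inv_into UNIV \<iota> u))" for u
  have F: "F (\<iota> w) = C (p w)" for w using \<iota> by (simp add: F_def)
  define P where "P = product_group (range \<iota>) F"
  have F_group: "group (F u)" for u using C(1)[OF p] by (simp add: F_def)
  interpret P: group P unfolding P_def by (rule product_group) (rule F_group)
  \<comment> \<open>The code of the graph of a member of the product.\<close>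
  define m where "m \<psi> = e (range (\<lambda>w. j (w, inv_into UNIV \<nu> (\<psi> (\<iota> w)))))" for \<psi> :: "'u \<Rightarrow> 'u"
  have m: "inj_on m (carrier P)"
  proof (rule inj_onI)
    fix \<phi> \<psi> assume \<phi>\<psi>: "\<phi> \<in> carrier P" "\<psi> \<in> carrier P" and "m \<phi> = m \<psi>"
    then have ranges: "range (\<lambda>w. j (w, inv_into UNIV \<nu> (\<phi> (\<iota> w)))) = range (\<lambda>w. j (w, inv_into UNIV \<nu> (\<psi> (\<iota> w))))"
      using e by (simp add: m_def inj_eq)
    show "\<phi> = \<psi>"
    proof (rule PiE_ext)
      show "\<phi> \<in> (\<Pi>\<^sub>E u\<in>range \<iota>. carrier (F u))" "\<psi> \<in> (\<Pi>\<^sub>E u\<in>range \<iota>. carrier (F u))"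
        using \<phi>\<psi> by (simp_all add: P_def)
      fix u assume "u \<in> range \<iota>"
      then obtain w where u: "u = \<iota> w" by blast
      have "j (w, inv_into UNIV \<nu> (\<phi> u)) \<in> range (\<lambda>w. j (w, inv_into UNIV \<nu> (\<psi> (\<iota> w))))"
        unfolding ranges[symmetric] u by blast
      then have "inv_into UNIV \<nu> (\<phi> u) = inv_into UNIV \<nu> (\<psi> u)" using j u by (auto simp: inj_eq)
      moreover have "\<phi> u \<in> carrier (C (p w))" "\<psi> u \<in> carrier (C (p w))"
        using \<phi>\<psi> unfolding P_def u carrier_product_group F[symmetric] by blast+
      then have "\<phi> u \<in> range \<nu>" "\<psi> u \<in> range \<nu>"
        unfolding C(3)[OF p] code_def by auto
      ultimately show "\<phi> u = \<psi> u" by (metis f_inv_into_f)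
    qed
  qed
  obtain P' :: "'u monoid" where P': "group P'" "m \<in> iso P P'" "carrier P' = m ` carrier P"
    by (rule ex_group_on_image[OF P.group_axioms m])
  interpret m: group_hom P P' m
    using P' by (simp add: group_hom_def group_hom_axioms_def iso_def P.group_axioms)
  have "C (p w) \<in> K" for w
    using affine_copy_in_U_class[OF inf p C(1)[OF p] C(2)[OF p]] K(2) by blast
  then have FK: "F ` range \<iota> \<subseteq> K" by (auto simp: F)
  have "P \<cong> P'" using P'(2) by (auto simp: is_iso_def)
  then have "P' \<in> K"
    using K(1) FK P'(1) unfolding variety_def closed_under_products_def P_def by metis

  define x where "x g = (\<lambda>u\<in>range \<iota>. code (a (inv_into UNIV \<iota> u) g))" for g
  have x: "range x \<subseteq> carrier P"
    using a by (force simp: x_def P_def F_def C(3)[OF p])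
  have law: "word_val G y w = \<one>\<^bsub>G\<^esub>" if "word_val P' (m \<circ> x) w = \<one>\<^bsub>P'\<^esub>" for w
  proof (rule sep)
    let ?A = "affine_group (p w)"
    have "m (word_val P x w) = m \<one>\<^bsub>P\<^esub>" using m.hom_word_val[OF x] that by simp
    then have 1: "word_val P x w = \<one>\<^bsub>P\<^esub>"
      by (rule inj_onD[OF m _ P.word_val_closed[OF x] P.one_closed])
    interpret pr: group_hom P "C (p w)" "\<lambda>\<psi>. \<psi> (\<iota> w)"
      using C(1)[OF p] P.group_axioms
      by (auto simp: group_hom_def group_hom_axioms_def hom_def P_def F[symmetric])
    interpret cd: group_hom ?A "C (p w)" code
      using C(1,2)[OF p] group_affine_group[OF p]
      by (simp add: group_hom_def group_hom_axioms_def iso_def)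
    have "(\<lambda>\<psi>. \<psi> (\<iota> w)) \<circ> x = code \<circ> a w" using \<iota> by (auto simp: x_def)
    then have "code (word_val ?A (a w) w) = code \<one>\<^bsub>?A\<^esub>"
      using pr.hom_word_val[OF x, of w] pr.hom_one cd.hom_word_val[OF a, of w] 1 by simp
    then show "word_val ?A (a w) w = \<one>\<^bsub>?A\<^esub>" by (rule injD[OF code])
  qed
  have "range (m \<circ> x) \<subseteq> carrier P'" using x by auto
  then obtain S h where S: "subgroup S P'" and h: "h \<in> epi (P'\<lparr>carrier := S\<rparr>) G"
    using word_laws_give_quotient_of_subgroup[OF P'(1) G.group_axioms _ y law] by blast
  obtain i where i: "i \<in> iso G H" using H(2) by (auto simp: is_iso_def)
  have "P'\<lparr>carrier := S\<rparr> \<in> K"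
    using K(1) \<open>P' \<in> K\<close> S unfolding variety_def closed_under_subgroups_def by blast
  moreover have "i \<circ> h \<in> epi (P'\<lparr>carrier := S\<rparr>) H"
    using h i by (intro epi_compose) (auto simp: iso_iff_mon_epi)
  ultimately show ?thesis
    using K(1) H(1) unfolding variety_def closed_under_images_def by blast
qed

theorem theorem6p1:
  assumes "large_universe TYPE('a) TYPE('u)"
  shows "(copies (generated_variety (U_class :: 'u monoid set)) :: 'a monoid set) = metabelian_groups"
proof
  have "generated_variety (U_class :: 'u monoid set) \<subseteq> metabelian_groups"
    using variety_metabelian U_class_metabelian unfolding generated_variety_def by blast
  then show "(copies (generated_variety (U_class :: 'u monoid set)) :: 'a monoid set) \<subseteq> metabelian_groups"
    using metabelian_iso group.iso_sym unfolding copies_def by blast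
  obtain e :: "('a + nat) set \<Rightarrow> 'u" where e: "inj e"
    using assms by (auto simp: large_universe_def)
  show "metabelian_groups \<subseteq> (copies (generated_variety (U_class :: 'u monoid set)) :: 'a monoid set)"
  proof
    fix G :: "'a monoid" assume G: "G \<in> metabelian_groups"
    then have "group G" by (simp add: metabelian_iff)
    have "inj_on (\<lambda>g. e {Inl g}) (carrier G)" using e by (auto simp: inj_on_def inj_def)
    then obtain H :: "'u monoid" where H: "group H" "(\<lambda>g. e {Inl g}) \<in> iso G H"
        "carrier H = (\<lambda>g. e {Inl g}) ` carrier G"
      by (rule ex_group_on_image[OF \<open>group G\<close>])
    have "G \<cong> H" using H(2) by (auto simp: is_iso_def)
    then have "H \<in> generated_variety (U_class :: 'u monoid set)"
      using metabelian_copy_in_variety[OF e _ _ G H(1)] unfolding generated_variety_def by blast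
    then show "G \<in> copies (generated_variety (U_class :: 'u monoid set))"
      using \<open>group G\<close> \<open>G \<cong> H\<close> unfolding copies_def by blast
  qed
qed

end
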